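(* Let $\mathcal{W}_L=\{\omega_l^{(L)}\}_{l=1}^L\subset\mathbb{R}$ ($L\in\mathbb{N}$) be deterministic weights satisfying $$\max_{1\le l\le L}|\omega_l^{(L)}|\to 0\quad (L\to\infty),$$ and put $\mathcal{W}_L^{+}=\{\omega_l^{(L)}\in\mathcal{W}_L : \omega_l^{(L)}>0\}$ and $\mathcal{W}_L^{-}=\{\omega_l^{(L)}\in\mathcal{W}_L : \omega_l^{(L)}<0\}$. Let $a,b\in\mathbb{R}$ with $a<b$. Consider the following two cases. (i) (Noise only, $E^{(l)}=\{v^{(l)}\}$.) The scalar system state has the form $x=x(U,v)$, where the noise $v$ is a random variable distributed on $(a,b)$, and its copies $v^{(l)}$, $l=1,2,\ldots$, in the different systems are i.i.d. The observation function $\phi$ is a real-valued function of the state. There exist constants $C_1,C_2\ge 0$, independent of $L$, with $\max\{C_1,C_2\}>0$ and $$\sum_{\omega_l^{(L)}\in\mathcal{W}_L^{+}}\omega_l^{(L)}=C_1,\qquad \sum_{\omega_l^{(L)}\in\mathcal{W}_L^{-}}|\omega_l^{(L)}|=C_2 .$$ (ii) (Temporal fluctuation only, $E^{(l)}=\{t,\boldsymbol{x}_0^{(l)}\}$.) The scalar system state $x(t)=x(t,U,\boldsymbol{x}_0)$, $t\ge 0$, is a function of $U$ and the initial value $\boldsymbol{x}_0$ with $x(t)\in(a,b)$. A sequence of initial values $\{\boldsymbol{x}_0^{(l)}\}_{l=1}^\infty$ is given, and for each $l\in\mathbb{N}$ $$x(t,U,\boldsymbol{x}_0^{(l)})=\sum_{j=1}^{N}\Bigl\{a_j\cos\bigl(f_j+\theta_j^{(l)}\bigr)+b_j\sin\bigl(f_j+\theta_j^{(l)}\bigr)\Bigr\}+C$$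 with smooth functions $a_j=a_j(U)$, $b_j=b_j(U)$, $f_j=f_j(t,U)$, $C=C(U)$ and phases $\theta_j^{(l)}$, $j=1,\ldots,N$. The dependence on the initial value is expressed only through the phases, and the $\theta_j^{(l)}$ ($1\le j\le N$, $l\ge 1$) are i.i.d. random variables uniformly distributed on $(-\pi,\pi)$. The observation function $\phi:(a,b)\to\mathbb{R}$ is analytic. Moreover: (ii-1) all weights in $\mathcal{W}_L$ have the same sign, i.e. $\mathcal{W}_L=\mathcal{W}_L^{+}$ or $\mathcal{W}_L=\mathcal{W}_L^{-}$; (ii-2) there is a constant $C_3>0$, independent of $L$, such that $\sum_{l=1}^L|\omega_l^{(L)}|=C_3$. Suppose that (i) or (ii) holds and that the weighted average $$\sum_{l=1}^{L}\omega_l^{(L)}\,\phi\bigl(x(U,E^{(l)})\bigr)$$ converges almost surely as $L\to\infty$ (in case (ii), for every $t\ge 0$), so that $\mathbb{E}[\phi(x)]:=\lim_{L\to\infty}\sum_{l=1}^{L}\omega_l^{(L)}\phi(x(U,E^{(l)}))$ is well defined. Then $\mathbb{E}[\phi(x)]$ is time-invariant.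
   Context: Setting: one considers infinitely many parallel copies ($l=1,2,\ldots$) of the same dynamical system, all driven by one common, fixed (deterministic) input history $U=\{u(t)\}_{t\ge0}$. The state of the $l$-th copy is a function $x(U,E^{(l)})$ of the input history and of error factors $E^{(l)}$, which may consist of noise, time $t$ and the initial value $\boldsymbol{x}_0^{(l)}$. The observation function $\phi$ is such that all the random quantities $\phi(x(U,E^{(l)}))$ are well-defined (measurable). The symbol $\mathbb{E}[\phi(x)]$ denotes the weighted ensemble average defined by the limit in the claim (it is not, by definition, a probabilistic expectation). Time-invariant: a quantity is time-invariant if it retains no dependence on the error factors $E$ (noise, time, initial values), i.e. it is determined by the input history $U$ alone. Thus here: there is a quantity $\Phi(U)$ depending only on $U$ such that $\mathbb{E}[\phi(x)]=\Phi(U)$ almost surely (in case (ii), for every $t\ge0$, with the same $\Phi(U)$ for all $t$). Analytic: $\phi:(a,b)\to\mathbb{R}$ is analytic on $(a,b)$ if for every $c\in(a,b)$ there is $R>0$ such that $\phi(x)=\sum_{n=0}^\infty \frac{\phi^{(n)}(c)}{n!}(x-c)^n$ for $|x-c|<R$, the series converging with sum $\phi(x)$. *)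

theory Defs
  imports "HOL-Probability.Probability"
begin

(* An input history {u(t)}_{t >= 0} is a function on [0, oo), encoded as an element of
   extensional {0..}.  Copies are numbered l = 1, 2, ...; "w L l" is the l-th weight of the
   L-th family.  Families are indexed (so repeated weights such as 1/L count with
   multiplicity), hence the positive and negative subfamilies are sets of indices. *)

type_synonym 'u history = "real \<Rightarrow> 'u"

definition pos_idx :: "(nat \<Rightarrow> nat \<Rightarrow> real) \<Rightarrow> nat \<Rightarrow> nat set" where
  "pos_idx w L = {l \<in> {1..L}. w L l > 0}"

definition neg_idx :: "(nat \<Rightarrow> nat \<Rightarrow> real) \<Rightarrow> nat \<Rightarrow> nat set" where
  "neg_idx w L = {l \<in> {1..L}. w L l < 0}"

definition weighted_avg :: "(nat \<Rightarrow> nat \<Rightarrow> real) \<Rightarrow> (nat \<Rightarrow> real) \<Rightarrow> nat \<Rightarrow> real" where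
  "weighted_avg w y L = (\<Sum>l=1..L. w L l * y l)"

definition ensemble_avg :: "(nat \<Rightarrow> nat \<Rightarrow> real) \<Rightarrow> (nat \<Rightarrow> real) \<Rightarrow> real" where
  "ensemble_avg w y = lim (weighted_avg w y)"

(* All derivatives exist on S, one-sided at boundary points; D n is the n-th derivative. *)
definition smooth_on :: "real set \<Rightarrow> (real \<Rightarrow> real) \<Rightarrow> bool" where
  "smooth_on S f \<longleftrightarrow> (\<exists>D :: nat \<Rightarrow> real \<Rightarrow> real. (\<forall>s\<in>S. D 0 s = f s) \<and>
     (\<forall>n. \<forall>s\<in>S. (D n has_real_derivative D (Suc n) s) (at s within S)))"

(* "deriv" at a point of the open interval depends only on the values of f in the interval;
   the expansion itself forces all these derivatives to exist. *)
definition real_analytic_on :: "(real \<Rightarrow> real) \<Rightarrow> real \<Rightarrow> real \<Rightarrow> bool" where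
  "real_analytic_on f a b \<longleftrightarrow> (\<forall>c\<in>{a<..<b}. \<exists>R>0. \<forall>s\<in>{a<..<b}. \<bar>s - c\<bar> < R \<longrightarrow>
     (\<lambda>n. (deriv ^^ n) f c / fact n * (s - c) ^ n) sums f s)"

(* In the two cases below, "S U t l \<omega>" is the state x(U, E^(l)) of the l-th copy at time t,
   where \<omega> in M is the sample point.

   Noise only.  The observable is measurable as a function of the noise: measurability on M
   of the composition with v l alone would not make the observed copies independent.
   The two sign conditions are required for all large L only: for L = 1 they cannot both
   hold with C1 > 0 and C2 > 0. *)
definition noise_only ::
  "'w measure \<Rightarrow> 'u history set \<Rightarrow> (nat \<Rightarrow> nat \<Rightarrow> real) \<Rightarrow> real \<Rightarrow> real \<Rightarrow> (real \<Rightarrow> real)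
   \<Rightarrow> ('u history \<Rightarrow> real \<Rightarrow> real) \<Rightarrow> (nat \<Rightarrow> 'w \<Rightarrow> real)
   \<Rightarrow> ('u history \<Rightarrow> real \<Rightarrow> nat \<Rightarrow> 'w \<Rightarrow> real) \<Rightarrow> bool" where
  "noise_only M UU w a b \<phi> x v S \<longleftrightarrow>
     (\<forall>U\<in>UU. \<forall>t\<ge>0. \<forall>l\<ge>1. \<forall>\<omega>\<in>space M. S U t l \<omega> = x U (v l \<omega>)) \<and>
     (\<forall>U\<in>UU. (\<lambda>s. \<phi> (x U s)) \<in> borel_measurable (restrict_space borel {a<..<b})) \<and>
     prob_space.indep_vars M (\<lambda>_. borel) v {1..} \<and>
     (\<forall>l\<ge>1. distr M borel (v l) = distr M borel (v 1)) \<and>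
     (\<forall>l\<ge>1. AE \<omega> in M. v l \<omega> \<in> {a<..<b}) \<and>
     (\<exists>C1 C2. C1 \<ge> 0 \<and> C2 \<ge> 0 \<and> max C1 C2 > 0 \<and>
        (\<forall>\<^sub>F L in sequentially.
           (\<Sum>l\<in>pos_idx w L. w L l) = C1 \<and> (\<Sum>l\<in>neg_idx w L. \<bar>w L l\<bar>) = C2))"

(* Temporal fluctuation only.  The initial values x0 l are random, since they determine the
   random phases.  No structure is put on the space of input histories, so no smoothness
   in U is required; smoothness of f_j in t is. *)
definition temporal_fluctuation_only ::
  "'w measure \<Rightarrow> 'u history set \<Rightarrow> (nat \<Rightarrow> nat \<Rightarrow> real) \<Rightarrow> real \<Rightarrow> real \<Rightarrow> (real \<Rightarrow> real)
   \<Rightarrow> (real \<Rightarrow> 'u history \<Rightarrow> 'i \<Rightarrow> real) \<Rightarrow> (nat \<Rightarrow> 'w \<Rightarrow> 'i)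
   \<Rightarrow> ('u history \<Rightarrow> real \<Rightarrow> nat \<Rightarrow> 'w \<Rightarrow> real) \<Rightarrow> bool" where
  "temporal_fluctuation_only M UU w a b \<phi> x x0 S \<longleftrightarrow>
     (\<forall>U\<in>UU. \<forall>t\<ge>0. \<forall>l\<ge>1. \<forall>\<omega>\<in>space M. S U t l \<omega> = x t U (x0 l \<omega>)) \<and>
     (\<forall>U\<in>UU. \<forall>t\<ge>0. \<forall>l\<ge>1. \<forall>\<omega>\<in>space M. x t U (x0 l \<omega>) \<in> {a<..<b}) \<and>
     (\<exists>(N :: nat) (\<alpha> :: nat \<Rightarrow> 'u history \<Rightarrow> real) (\<beta> :: nat \<Rightarrow> 'u history \<Rightarrow> real)
        (f :: nat \<Rightarrow> real \<Rightarrow> 'u history \<Rightarrow> real) (C :: 'u history \<Rightarrow> real)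
        (\<theta> :: nat \<Rightarrow> nat \<Rightarrow> 'w \<Rightarrow> real).
        (\<forall>U\<in>UU. \<forall>j\<in>{1..N}. smooth_on {0..} (\<lambda>t. f j t U)) \<and>
        (\<forall>U\<in>UU. \<forall>t\<ge>0. \<forall>l\<ge>1. \<forall>\<omega>\<in>space M. x t U (x0 l \<omega>) =
           (\<Sum>j=1..N. \<alpha> j U * cos (f j t U + \<theta> j l \<omega>) + \<beta> j U * sin (f j t U + \<theta> j l \<omega>)) + C U) \<and>
        prob_space.indep_vars M (\<lambda>_. borel) (\<lambda>(j, l). \<theta> j l) ({1..N} \<times> {1..}) \<and>
        (\<forall>j\<in>{1..N}. \<forall>l\<ge>1. distr M borel (\<theta> j l) = uniform_measure lborel {-pi<..<pi})) \<and>
     real_analytic_on \<phi> a b \<and>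
     (\<forall>L\<ge>1. pos_idx w L = {1..L} \<or> neg_idx w L = {1..L}) \<and>
     (\<exists>C3>0. \<forall>L\<ge>1. (\<Sum>l=1..L. \<bar>w L l\<bar>) = C3)"

(* Phi is a function of the input history alone: it depends neither on t nor on the
   sample point. *)
definition time_invariant ::
  "'w measure \<Rightarrow> 'u history set \<Rightarrow> ('u history \<Rightarrow> real \<Rightarrow> 'w \<Rightarrow> real) \<Rightarrow> bool" where
  "time_invariant M UU A \<longleftrightarrow>
     (\<exists>\<Phi> :: 'u history \<Rightarrow> real. \<forall>U\<in>UU. \<forall>t\<ge>0. AE \<omega> in M. A U t \<omega> = \<Phi> U)"

end

theory Submission
  imports Defs
begin

text \<open>
  Every single weight tends to zero, so the limit of the weighted averages does not depend on any
  finite number of the copies; as the copies are independent, Kolmogorov's zero-one law makes it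
  almost surely constant. With noise only, the copies do not depend on time, hence neither does
  the constant. With temporal fluctuation only, the state depends on the phases through
  \<open>cis (f\<^sub>j + \<theta>\<^sub>j)\<close>, which is uniformly distributed on the unit circle whatever the value of
  \<open>f\<^sub>j\<close>. So the joint law of all copies, and with it the constant, is the same at all times.
\<close>

section \<open>Zero-one law for the ensemble average\<close>

text \<open>The distribution function of \<open>Z\<close> takes only the values 0 and 1, so it is a
  single jump, and all the mass sits at the jump point.\<close>

lemma (in prob_space) AE_const_if_zero_one:
  fixes Z :: "'a \<Rightarrow> real"
  assumes Z [measurable]: "Z \<in> borel_measurable M"
    and zero_one: "\<And>q. prob {\<omega> \<in> space M. Z \<omega> \<le> q} = 0 \<or> prob {\<omega> \<in> space M. Z \<omega> \<le> q} = 1"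
  shows "\<exists>c. AE \<omega> in M. Z \<omega> = c"
proof -
  interpret D: real_distribution "distr M borel Z" by simp
  let ?F = "cdf (distr M borel Z)"
  have F: "?F q = prob {\<omega> \<in> space M. Z \<omega> \<le> q}" for q
    by (auto simp: cdf_def measure_distr intro!: arg_cong[where f=prob])
  \<comment> \<open>The jump point \<open>c\<close> is the infimum of the levels reached with
    probability 1. The limits 1 at infinity and 0 at minus infinity make \<open>A\<close> nonempty
    and bounded below.\<close>
  define A where "A = {q. ?F q = 1}"
  define c where "c = Inf A"
  have "\<forall>\<^sub>F q in at_top. ?F q > 0"
    using D.cdf_lim_at_top_prob by (rule order_tendstoD) simp
  then obtain q1 where "?F q1 > 0"
    by (meson eventually_at_top_linorder order_refl)
  then have ne: "A \<noteq> {}"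
    using zero_one[of q1] F by (auto simp: A_def)
  have "\<forall>\<^sub>F q in at_bot. ?F q < 1"
    using D.cdf_lim_at_bot by (rule order_tendstoD) simp
  then obtain q0 where q0: "?F q0 < 1"
    by (meson eventually_at_bot_linorder order_refl)
  have bdd: "bdd_below A"
  proof (rule bdd_belowI)
    fix q assume "q \<in> A"
    then show "q0 \<le> q"
      using q0 D.cdf_nondecreasing[of q q0] by (force simp: A_def)
  qed
  have above: "AE \<omega> in M. Z \<omega> \<le> c + inverse (real (Suc n))" for n
  proof -
    have "c < c + inverse (real (Suc n))" by simp
    then obtain q where "q \<in> A" and q: "q < c + inverse (real (Suc n))"
      using ne cInf_lessD unfolding c_def by blast
    then have "AE \<omega> in M. Z \<omega> \<le> q"
      using F by (subst prob_Collect_eq_1[symmetric]) (auto simp: A_def)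
    then show ?thesis using q by (auto elim!: eventually_mono)
  qed
  \<comment> \<open>Strictly below the infimum of \<open>A\<close> the distribution function is not
    1, hence it is 0.\<close>
  have below: "AE \<omega> in M. c - inverse (real (Suc n)) < Z \<omega>" for n
  proof -
    have "c - inverse (real (Suc n)) \<notin> A"
      using cInf_lower[OF _ bdd] by (force simp: c_def)
    then have "AE \<omega> in M. \<not> Z \<omega> \<le> c - inverse (real (Suc n))"
      using zero_one[of "c - inverse (real (Suc n))"] F
      by (subst prob_Collect_eq_0[symmetric]) (auto simp: A_def)
    then show ?thesis by (simp add: not_le)
  qed
  have "AE \<omega> in M. \<forall>n. Z \<omega> \<le> c + inverse (real (Suc n)) \<and> c - inverse (real (Suc n)) < Z \<omega>"
    using above below by (simp add: AE_all_countable)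
  then have "AE \<omega> in M. Z \<omega> = c"
  proof eventually_elim
    case (elim \<omega>)
    have "(\<lambda>n. c + inverse (real (Suc n))) \<longlonglongrightarrow> c" "(\<lambda>n. c - inverse (real (Suc n))) \<longlonglongrightarrow> c"
      using tendsto_add[OF tendsto_const LIMSEQ_inverse_real_of_nat, of c]
        tendsto_diff[OF tendsto_const LIMSEQ_inverse_real_of_nat, of c] by simp_all
    then have "Z \<omega> \<le> c" "c \<le> Z \<omega>"
      using elim by (auto intro: LIMSEQ_le_const LIMSEQ_le_const2 less_imp_le)
    then show ?case by simp
  qed
  then show ?thesis ..
qed

text \<open>
  This also holds for divergent sequences: \<open>lim X\<close> is \<open>THE l. X \<longlonglongrightarrow> l\<close>, so it is determined by
  the set of limits of \<open>X\<close>. Hence convergence plays no role in the zero-one law below.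
\<close>
lemma lim_cong_diff_null:
  fixes X Y :: "nat \<Rightarrow> 'a::real_normed_vector"
  assumes "(\<lambda>n. X n - Y n) \<longlonglongrightarrow> 0"
  shows "lim X = lim Y"
proof -
  have "X \<longlonglongrightarrow> l \<longleftrightarrow> Y \<longlonglongrightarrow> l" for l
    using tendsto_diff[OF _ assms, of X l] tendsto_add[OF _ assms, of Y l] by auto
  then show ?thesis by (simp add: lim_def)
qed

lemma ensemble_avg_measurable:
  assumes "\<And>l. l \<ge> 1 \<Longrightarrow> Y l \<in> borel_measurable N"
  shows "(\<lambda>\<omega>. ensemble_avg w (\<lambda>l. Y l \<omega>)) \<in> borel_measurable N"
  unfolding ensemble_avg_def weighted_avg_def
  by (intro borel_measurable_lim_metric borel_measurable_sum borel_measurable_times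
      borel_measurable_const assms) simp

lemma ensemble_avg_cong:
  assumes "\<And>l. l \<ge> 1 \<Longrightarrow> y l = z l"
  shows "ensemble_avg w y = ensemble_avg w z"
  using assms by (auto simp: ensemble_avg_def weighted_avg_def intro!: arg_cong[where f=lim] sum.cong)

text \<open>The first \<open>n\<close> copies contribute a sum with a fixed number of terms, each of
  which tends to 0 with its weight. Zeroing these copies instead of dropping them keeps every weight
  attached to its copy.\<close>

lemma ensemble_avg_tail:
  assumes "\<And>l. l \<ge> 1 \<Longrightarrow> (\<lambda>L. w L l) \<longlonglongrightarrow> 0"
  shows "ensemble_avg w y = ensemble_avg w (\<lambda>l. if l \<le> n then 0 else y l)"
  unfolding ensemble_avg_def
proof (rule lim_cong_diff_null)
  have "(\<lambda>L. \<Sum>l=1..n. w L l * y l) \<longlonglongrightarrow> (\<Sum>l=1..n. 0 * y l)"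
    using assms by (intro tendsto_sum tendsto_mult_right) auto
  \<comment> \<open>As soon as \<open>L\<close> is at least \<open>n\<close>, the range of summation
    of the difference no longer grows with \<open>L\<close>.\<close>
  moreover have "\<forall>\<^sub>F L in sequentially. (\<Sum>l=1..n. w L l * y l) =
      weighted_avg w y L - weighted_avg w (\<lambda>l. if l \<le> n then 0 else y l) L"
    using eventually_ge_at_top[of n]
  proof eventually_elim
    case (elim L)
    have "weighted_avg w y L - weighted_avg w (\<lambda>l. if l \<le> n then 0 else y l) L =
        (\<Sum>l=1..L. if l \<le> n then w L l * y l else 0)"
      unfolding weighted_avg_def sum_subtractf[symmetric] by (intro sum.cong) auto
    also have "\<dots> = (\<Sum>l=1..n. w L l * y l)"
      using elim by (subst sum.inter_filter[symmetric]) (auto intro!: sum.cong)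
    finally show ?case ..
  qed
  ultimately show "(\<lambda>L. weighted_avg w y L - weighted_avg w (\<lambda>l. if l \<le> n then 0 else y l) L) \<longlonglongrightarrow> 0"
    by (simp add: tendsto_cong)
qed

text \<open>For every \<open>n\<close> the average is a function of the copies after the
  \<open>n\<close>-th, so each of its sublevel sets is a tail event of an independent
  sequence.\<close>

lemma (in prob_space) ensemble_avg_AE_const:
  fixes Y :: "nat \<Rightarrow> 'a \<Rightarrow> real"
  assumes indep: "indep_vars (\<lambda>_. borel) Y {1..}"
    and w: "\<And>l. l \<ge> 1 \<Longrightarrow> (\<lambda>L. w L l) \<longlonglongrightarrow> 0"
  shows "\<exists>c. AE \<omega> in M. ensemble_avg w (\<lambda>l. Y l \<omega>) = c"
proof (rule AE_const_if_zero_one)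
  have Y: "Y l \<in> borel_measurable M" if "l \<ge> 1" for l
    using indep that by (auto simp: indep_vars_def)
  show "(\<lambda>\<omega>. ensemble_avg w (\<lambda>l. Y l \<omega>)) \<in> borel_measurable M"
    by (rule ensemble_avg_measurable[OF Y])
  fix q
  \<comment> \<open>The sigma-algebra generated by copy \<open>Suc i\<close>: copies are numbered
    from 1, whereas Kolmogorov's law indexes the sigma-algebras from 0.\<close>
  define A where "A i = {Y (Suc i) -` B \<inter> space M |B. B \<in> sets borel}" for i
  let ?E = "{\<omega> \<in> space M. ensemble_avg w (\<lambda>l. Y l \<omega>) \<le> q}"
  show "prob ?E = 0 \<or> prob ?E = 1"
  proof (rule kolmogorov_0_1_law[of A])
    show "sigma_algebra (space M) (A i)" for i
      using sets.sigma_algebra_axioms[of "vimage_algebra (space M) (Y (Suc i)) borel"]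
      by (simp add: A_def sets_vimage_algebra2)
    have ind: "indep_sets (\<lambda>i. {Y i -` B \<inter> space M |B. B \<in> sets borel}) {1..}"
      using indep by (simp add: indep_vars_def2)
    show "indep_sets A UNIV"
    proof (rule indep_setsI)
      show "A i \<subseteq> events" for i
        using measurable_sets[OF Y, of "Suc i"] by (auto simp: A_def)
      fix B J assume J: "J \<noteq> {}" "finite J" "\<forall>j\<in>J. B j \<in> A j"
      have "prob (\<Inter>j\<in>Suc ` J. B (j - 1)) = (\<Prod>j\<in>Suc ` J. prob (B (j - 1)))"
        using J by (intro indep_setsD[OF ind]) (auto simp: A_def)
      then show "prob (\<Inter>j\<in>J. B j) = (\<Prod>j\<in>J. prob (B j))"
        by (simp add: prod.reindex)
    qed
    show "?E \<in> tail_events A"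
      unfolding tail_events_def
    proof
      fix n
      \<comment> \<open>Because of the index shift, \<open>N\<close> is generated by exactly the
        copies with \<open>l > n\<close>. These are the ones that survive in
        \<open>ensemble_avg_tail\<close>.\<close>
      define N where "N = sigma (space M) (\<Union> (A ` {n..}))"
      have sub: "\<Union> (A ` {n..}) \<subseteq> Pow (space M)"
        by (auto simp: A_def)
      have space_N: "space N = space M"
        and sets_N: "sets N = sigma_sets (space M) (\<Union> (A ` {n..}))"
        using sub by (simp_all add: N_def)
      have YN: "Y l \<in> borel_measurable N" if "l > n" for l
      proof (rule measurableI)
        fix B :: "real set" assume "B \<in> sets borel"
        then have "Y l -` B \<inter> space M \<in> A (l - 1)"
          using that by (auto simp: A_def)
        then show "Y l -` B \<inter> space N \<in> sets N"
          unfolding sets_N space_N using that by (intro sigma_sets.Basic) force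
      qed simp
      have "(\<lambda>\<omega>. ensemble_avg w (\<lambda>l. if l \<le> n then 0 else Y l \<omega>)) \<in> borel_measurable N"
      proof (rule ensemble_avg_measurable)
        show "(\<lambda>\<omega>. if l \<le> n then 0 else Y l \<omega>) \<in> borel_measurable N" for l
          using YN by (cases "l \<le> n") auto
      qed
      then have "{\<omega> \<in> space N. ensemble_avg w (\<lambda>l. if l \<le> n then 0 else Y l \<omega>) \<le> q} \<in> sets N"
        by measurable
      moreover have "?E = {\<omega> \<in> space N. ensemble_avg w (\<lambda>l. if l \<le> n then 0 else Y l \<omega>) \<le> q}"
        unfolding space_N using ensemble_avg_tail[of w _ n] w by simp
      ultimately show "?E \<in> sigma_sets (space M) (\<Union> (A ` {n..}))"
        by (simp only: sets_N)
    qed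
  qed
qed

section \<open>Continuity of the observable, and laws of the phases\<close>

text \<open>A power series is continuous at its centre, where its value is the zeroth coefficient,
  here \<open>f c\<close>. This makes the observable Borel measurable on the interval.\<close>

lemma continuous_on_real_analytic_on:
  assumes "real_analytic_on f a b"
  shows "continuous_on {a<..<b} f"
proof (rule continuous_at_imp_continuous_on, rule ballI)
  fix c assume c: "c \<in> {a<..<b}"
  then obtain R where R: "R > 0" "\<And>s. s \<in> {a<..<b} \<Longrightarrow> \<bar>s - c\<bar> < R \<Longrightarrow>
      (\<lambda>n. (deriv ^^ n) f c / fact n * (s - c) ^ n) sums f s"
    using assms unfolding real_analytic_on_def by blast
  \<comment> \<open>This radius keeps \<open>c + h\<close> inside the interval, where the expansion
    is available.\<close>
  define r where "r = min R (min (c - a) (b - c))"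
  have "r > 0" using R c by (simp add: r_def)
  moreover have "(\<lambda>n. (deriv ^^ n) f c / fact n * h ^ n) sums f (c + h)" if "norm h < r" for h
    using R(2)[of "c + h"] that by (simp add: r_def abs_less_iff)
  ultimately have "((\<lambda>h. f (c + h)) \<longlongrightarrow> (deriv ^^ 0) f c / fact 0) (at 0)"
    by (rule powser_limit_0)
  then show "isCont f c"
    by (simp add: isCont_iff)
qed

text \<open>A shifted period is a period with another starting point. The part that sticks out on
  the right, moved back by \<open>p\<close>, fills the gap on the left; half-open intervals make the
  pieces fit without overlap.\<close>

lemma nn_integral_periodic_shift:
  fixes h :: "real \<Rightarrow> ennreal"
  assumes [measurable]: "h \<in> borel_measurable borel" and "p > 0"
    and periodic: "\<And>s. h (s + p) = h s"
  shows "(\<integral>\<^sup>+s. h (c + s) * indicator {u..<u + p} s \<partial>lborel) =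
    (\<integral>\<^sup>+s. h s * indicator {u..<u + p} s \<partial>lborel)"
proof -
  have periodic_int: "h (s + of_int k * p) = h s" for s k
  proof (induction k rule: int_induct[where k=0])
    case (step1 i)
    then show ?case using periodic[of "s + of_int i * p"] by (simp add: algebra_simps)
  next
    case (step2 i)
    then show ?case using periodic[of "s + of_int (i - 1) * p"] by (simp add: algebra_simps)
  qed simp
  \<comment> \<open>The shift reduced modulo the period: with \<open>0 \<le> d < p\<close> a single
    cut at \<open>u + p\<close> is enough.\<close>
  define d where "d = c - of_int \<lfloor>c / p\<rfloor> * p"
  have d: "0 \<le> d" "d < p"
    using \<open>p > 0\<close> floor_divide_lower[of p c] floor_divide_upper[of p c]
    by (auto simp: d_def algebra_simps)
  have hd: "h (c + s) = h (d + s)" for s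
    using periodic_int[of "d + s" "\<lfloor>c / p\<rfloor>"] by (simp add: d_def algebra_simps)
  have "(\<integral>\<^sup>+s. h (c + s) * indicator {u..<u + p} s \<partial>lborel) =
      (\<integral>\<^sup>+s. h (d + s) * indicator {u + d..<u + d + p} (d + s) \<partial>lborel)"
    by (intro nn_integral_cong) (auto simp: hd split: split_indicator)
  also have "\<dots> = (\<integral>\<^sup>+s. h s * indicator {u + d..<u + d + p} s \<partial>lborel)"
    using nn_integral_real_affine[of "\<lambda>s. h s * indicator {u + d..<u + d + p} s" 1 d] by simp
  also have "\<dots> = (\<integral>\<^sup>+s. h s * indicator {u + d..<u + p} s + h s * indicator {u + p..<u + d + p} s \<partial>lborel)"
    using d by (intro nn_integral_cong) (auto split: split_indicator)
  also have "\<dots> = (\<integral>\<^sup>+s. h s * indicator {u + d..<u + p} s \<partial>lborel) +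
      (\<integral>\<^sup>+s. h s * indicator {u + p..<u + d + p} s \<partial>lborel)"
    by (intro nn_integral_add) auto
  \<comment> \<open>The overhang beyond \<open>u + p\<close> is translated back by one
    period.\<close>
  also have "(\<integral>\<^sup>+s. h s * indicator {u + p..<u + d + p} s \<partial>lborel) =
      (\<integral>\<^sup>+s. h (p + s) * indicator {u + p..<u + d + p} (p + s) \<partial>lborel)"
    using nn_integral_real_affine[of "\<lambda>s. h s * indicator {u + p..<u + d + p} s" 1 p] by simp
  also have "\<dots> = (\<integral>\<^sup>+s. h s * indicator {u..<u + d} s \<partial>lborel)"
    using periodic by (intro nn_integral_cong) (auto simp: add.commute split: split_indicator)
  also have "(\<integral>\<^sup>+s. h s * indicator {u + d..<u + p} s \<partial>lborel) + \<dots> =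
      (\<integral>\<^sup>+s. h s * indicator {u + d..<u + p} s + h s * indicator {u..<u + d} s \<partial>lborel)"
    by (intro nn_integral_add[symmetric]) auto
  also have "\<dots> = (\<integral>\<^sup>+s. h s * indicator {u..<u + p} s \<partial>lborel)"
    using d by (intro nn_integral_cong) (auto split: split_indicator)
  finally show ?thesis .
qed

text \<open>Rotation invariance of the uniform law on the unit circle. Passing to \<open>cis\<close>
  is essential: the shifted angle itself is uniform on a different interval, and only its class
  modulo \<open>2 * pi\<close> keeps its law.\<close>

lemma distr_cis_shift_uniform:
  "distr (uniform_measure lborel {-pi<..<pi}) borel (\<lambda>s. cis (c + s)) =
   distr (uniform_measure lborel {-pi<..<pi}) borel cis"
proof (rule measure_eqI)
  fix B :: "complex set"
  assume "B \<in> sets (distr (uniform_measure lborel {-pi<..<pi}) borel (\<lambda>s. cis (c + s)))"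
  then have [measurable]: "B \<in> sets borel" by simp
  have [measurable]: "cis \<in> borel_measurable borel"
    by (intro borel_measurable_continuous_onI continuous_intros)
  have *: "emeasure (distr (uniform_measure lborel {-pi<..<pi}) borel (\<lambda>s. cis (d + s))) B =
      (\<integral>\<^sup>+s. indicator B (cis (d + s)) * indicator {-pi..<-pi + 2 * pi} s \<partial>lborel)
        / emeasure lborel {-pi<..<pi}" for d
  proof -
    have "emeasure (distr (uniform_measure lborel {-pi<..<pi}) borel (\<lambda>s. cis (d + s))) B =
        (\<integral>\<^sup>+s. indicator B s \<partial>distr (uniform_measure lborel {-pi<..<pi}) borel (\<lambda>s. cis (d + s)))"
      by simp
    also have "\<dots> = (\<integral>\<^sup>+s. indicator B (cis (d + s)) \<partial>uniform_measure lborel {-pi<..<pi})"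
      by (subst nn_integral_distr) (auto simp: measurable_cong_sets[OF sets_uniform_measure refl])
    also have "\<dots> = (\<integral>\<^sup>+s. indicator B (cis (d + s)) * indicator {-pi<..<pi} s \<partial>lborel)
        / emeasure lborel {-pi<..<pi}"
      by (subst nn_integral_uniform_measure) auto
    \<comment> \<open>Adding the null point \<open>-pi\<close> yields a half-open period.\<close>
    also have "(\<integral>\<^sup>+s. indicator B (cis (d + s)) * indicator {-pi<..<pi} s \<partial>lborel) =
       (\<integral>\<^sup>+s. indicator B (cis (d + s)) * indicator {-pi..<-pi + 2 * pi} s \<partial>lborel)"
      using AE_lborel_singleton[of "-pi"]
      by (intro nn_integral_cong_AE) (auto elim!: eventually_mono split: split_indicator)
    finally show ?thesis .
  qed
  have "cis (s + 2 * pi) = cis s" for s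
    by (simp add: cis_mult[symmetric])
  then show "emeasure (distr (uniform_measure lborel {-pi<..<pi}) borel (\<lambda>s. cis (c + s))) B =
      emeasure (distr (uniform_measure lborel {-pi<..<pi}) borel cis) B"
    using *[of c] *[of 0] nn_integral_periodic_shift[of "\<lambda>s. indicator B (cis s)" "2 * pi" c "-pi"]
    by simp
qed simp

text \<open>Independence makes each joint law the product of its marginals, so the two joint laws
  agree, and almost sure validity of a measurable property depends on the joint law only.\<close>

lemma (in prob_space) AE_indep_vars_iff_if_distr_eq:
  assumes "indep_vars N X I" "indep_vars N Y I"
    and "\<And>i. i \<in> I \<Longrightarrow> distr M (N i) (X i) = distr M (N i) (Y i)"
    and P: "{z \<in> space (PiM I N). P z} \<in> sets (PiM I N)"
  shows "(AE \<omega> in M. P (\<lambda>i\<in>I. X i \<omega>)) \<longleftrightarrow> (AE \<omega> in M. P (\<lambda>i\<in>I. Y i \<omega>))"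
proof (cases "I = {}")
  case False
  have X: "X i \<in> measurable M (N i)" and Y: "Y i \<in> measurable M (N i)" if "i \<in> I" for i
    using assms(1,2) that by (auto simp: indep_vars_def)
  have "distr M (PiM I N) (\<lambda>\<omega>. \<lambda>i\<in>I. X i \<omega>) = distr M (PiM I N) (\<lambda>\<omega>. \<lambda>i\<in>I. Y i \<omega>)"
    using assms(1-3) False X Y by (simp add: indep_vars_iff_distr_eq_PiM' cong: PiM_cong)
  moreover have AE_distr: "(AE \<omega> in M. P (\<lambda>i\<in>I. Z i \<omega>)) \<longleftrightarrow> (AE z in distr M (PiM I N) (\<lambda>\<omega>. \<lambda>i\<in>I. Z i \<omega>). P z)"
    if "\<And>i. i \<in> I \<Longrightarrow> Z i \<in> measurable M (N i)" for Z
    using that P by (subst AE_distr_iff) (auto intro!: measurable_restrict)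
  ultimately show ?thesis
    using AE_distr[OF X] AE_distr[OF Y] by metis
\<comment> \<open>Over an empty index set both families restrict to the same constant function. This
  case arises for \<open>N = 0\<close> phases per copy.\<close>
qed (simp add: restrict_def)

section \<open>The two cases and the conclusion\<close>

text \<open>Extension by zero: observables are controlled on the interval only, while composing with
  real random variables calls for a function measurable on the whole line.\<close>

lemma borel_measurable_indicator_times:
  fixes f :: "'b \<Rightarrow> real"
  assumes "f \<in> borel_measurable (restrict_space N A)" and "A \<inter> space N \<in> sets N"
  shows "(\<lambda>s. indicator A s * f s) \<in> borel_measurable N"
  using assms by (subst (asm) borel_measurable_restrict_space_iff) auto

lemma time_invariantI:
  assumes "\<And>U. U \<in> UU \<Longrightarrow> \<exists>c. \<forall>t\<ge>0. AE \<omega> in M. A U t \<omega> = c"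
  shows "time_invariant M UU A"
  unfolding time_invariant_def using assms by (intro bchoice) auto

lemma time_invariant_if_noise_only:
  assumes "prob_space M" and w: "\<And>l. l \<ge> 1 \<Longrightarrow> (\<lambda>L. w L l) \<longlonglongrightarrow> 0"
    and noise: "noise_only M UU w a b \<phi> x v S"
  shows "time_invariant M UU (\<lambda>U t \<omega>. ensemble_avg w (\<lambda>l. \<phi> (S U t l \<omega>)))"
proof (rule time_invariantI)
  interpret prob_space M by fact
  fix U assume U: "U \<in> UU"
  define h where "h s = indicator {a<..<b} s * \<phi> (x U s)" for s
  have S: "\<forall>t\<ge>0. \<forall>l\<ge>1. \<forall>\<omega>\<in>space M. S U t l \<omega> = x U (v l \<omega>)"
    and meas: "(\<lambda>s. \<phi> (x U s)) \<in> borel_measurable (restrict_space borel {a<..<b})"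
    and indep: "indep_vars (\<lambda>_. borel) v {1..}"
    and range: "\<forall>l\<ge>1. AE \<omega> in M. v l \<omega> \<in> {a<..<b}"
    using noise U unfolding noise_only_def by simp_all
  from meas have h: "h \<in> borel_measurable borel"
    unfolding h_def[abs_def] by (rule borel_measurable_indicator_times) simp
  have "indep_vars (\<lambda>_. borel) (\<lambda>l \<omega>. h (v l \<omega>)) {1..}"
    using indep_vars_compose2[OF indep, of "\<lambda>_. h" "\<lambda>_. borel"] h by simp
  from ensemble_avg_AE_const[OF this w]
  obtain c where c: "AE \<omega> in M. ensemble_avg w (\<lambda>l. h (v l \<omega>)) = c"
    by (rule exE)
  \<comment> \<open>The countably many exceptional null sets, one per copy, are merged into
    one.\<close>
  have "\<forall>l. AE \<omega> in M. l \<ge> 1 \<longrightarrow> v l \<omega> \<in> {a<..<b}"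
    using range by auto
  then have v: "AE \<omega> in M. \<forall>l\<ge>1. v l \<omega> \<in> {a<..<b}"
    by (simp add: AE_all_countable)
  have "AE \<omega> in M. ensemble_avg w (\<lambda>l. \<phi> (S U t l \<omega>)) = c" if "t \<ge> 0" for t
    using c v AE_space
  proof eventually_elim
    case (elim \<omega>)
    have "\<phi> (S U t l \<omega>) = h (v l \<omega>)" if "l \<ge> 1" for l
    proof -
      have "S U t l \<omega> = x U (v l \<omega>)"
        using S \<open>t \<ge> 0\<close> elim(3) that by blast
      then show ?thesis using elim(2) that by (simp add: h_def)
    qed
    then show ?case using elim(1) by (simp cong: ensemble_avg_cong)
  qed
  then show "\<exists>c. \<forall>t\<ge>0. AE \<omega> in M. ensemble_avg w (\<lambda>l. \<phi> (S U t l \<omega>)) = c"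
    by blast
qed

lemma time_invariant_if_temporal_fluctuation_only:
  assumes "prob_space M" and w: "\<And>l. l \<ge> 1 \<Longrightarrow> (\<lambda>L. w L l) \<longlonglongrightarrow> 0"
    and fluct: "temporal_fluctuation_only M UU w a b \<phi> x x0 S"
  shows "time_invariant M UU (\<lambda>U t \<omega>. ensemble_avg w (\<lambda>l. \<phi> (S U t l \<omega>)))"
proof (rule time_invariantI)
  interpret prob_space M by fact
  fix U assume U: "U \<in> UU"
  obtain N :: nat and \<alpha> \<beta> f C \<theta> where
    forms: "\<forall>U\<in>UU. \<forall>t\<ge>0. \<forall>l\<ge>1. \<forall>\<omega>\<in>space M. x t U (x0 l \<omega>) =
        (\<Sum>j=1..N. \<alpha> j U * cos (f j t U + \<theta> j l \<omega>) + \<beta> j U * sin (f j t U + \<theta> j l \<omega>)) + C U"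
    and indep: "indep_vars (\<lambda>_. borel) (\<lambda>(j, l). \<theta> j l) ({1..N} \<times> {1..})"
    and unif: "\<forall>j\<in>{1..N}. \<forall>l\<ge>1. distr M borel (\<theta> j l) = uniform_measure lborel {-pi<..<pi}"
    using fluct unfolding temporal_fluctuation_only_def by (elim conjE exE) (rule that; assumption)
  have form: "x t U (x0 l \<omega>) =
      (\<Sum>j=1..N. \<alpha> j U * cos (f j t U + \<theta> j l \<omega>) + \<beta> j U * sin (f j t U + \<theta> j l \<omega>)) + C U"
    if "t \<ge> 0" "l \<ge> 1" "\<omega> \<in> space M" for t l \<omega>
    using forms[rule_format, OF U that] .
  have in_ab: "x t U (x0 l \<omega>) \<in> {a<..<b}" and S: "S U t l \<omega> = x t U (x0 l \<omega>)"
    if "t \<ge> 0" "l \<ge> 1" "\<omega> \<in> space M" for t l \<omega>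
    using fluct U that by (simp_all add: temporal_fluctuation_only_def)
  define h where "h s = indicator {a<..<b} s * \<phi> s" for s
  have "\<phi> \<in> borel_measurable (restrict_space borel {a<..<b})"
    using fluct by (intro borel_measurable_continuous_on_restrict continuous_on_real_analytic_on)
      (simp add: temporal_fluctuation_only_def)
  then have h [measurable]: "h \<in> borel_measurable borel"
    unfolding h_def[abs_def] by (rule borel_measurable_indicator_times) simp
  define I where "I = {1..N} \<times> {1::nat..}"
  \<comment> \<open>Time enters through the circle points \<open>Z t\<close> alone. The map
    \<open>H l\<close>, which recovers the observed copy \<open>l\<close> from them as real and
    imaginary parts, is the same at all times because the amplitudes and the offset depend only on
    \<open>U\<close>.\<close>
  define Z where "Z t = (\<lambda>(j, l) \<omega>. cis (f j t U + \<theta> j l \<omega>))" for t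
  define H where "H l z = h ((\<Sum>j=1..N. \<alpha> j U * Re (z (j, l)) + \<beta> j U * Im (z (j, l))) + C U)"
    for l :: nat and z :: "nat \<times> nat \<Rightarrow> complex"
  have cis_shift: "(\<lambda>s. cis (d + s)) \<in> borel_measurable borel" for d
    by (intro borel_measurable_continuous_onI continuous_intros)
  have indep_Z: "indep_vars (\<lambda>_. borel) (Z t) I" for t
    using indep_vars_compose2[OF indep, of "\<lambda>(j, l) s. cis (f j t U + s)" "\<lambda>_. borel"] cis_shift
    by (simp add: I_def Z_def case_prod_beta' split_beta)
  have distr_Z: "distr M borel (Z t i) = distr (uniform_measure lborel {-pi<..<pi}) borel cis"
    if "i \<in> I" for t i
  proof -
    obtain j l where i: "i = (j, l)" "j \<in> {1..N}" "l \<ge> 1"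
      using \<open>i \<in> I\<close> by (auto simp: I_def)
    have "\<theta> j l \<in> borel_measurable M"
      using indep i by (auto simp: indep_vars_def)
    then have "distr M borel (Z t i) = distr (distr M borel (\<theta> j l)) borel (\<lambda>s. cis (f j t U + s))"
      using cis_shift by (simp add: distr_distr i Z_def comp_def)
    then show ?thesis
      using unif i distr_cis_shift_uniform by simp
  qed
  \<comment> \<open>\<open>H l\<close> reads only the coordinates of copy \<open>l\<close>. Two
    choices of \<open>J\<close> occur: this block, for independence of the copies, and all of
    \<open>I\<close>, for comparing joint laws.\<close>
  have H: "H l \<in> borel_measurable (PiM J (\<lambda>_. borel))" if "{1..N} \<times> {l} \<subseteq> J" for l J
  proof -
    have [measurable]: "(\<lambda>z. z (j, l)) \<in> borel_measurable (PiM J (\<lambda>_. borel))" if "j \<in> {1..N}" for j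
      using that \<open>{1..N} \<times> {l} \<subseteq> J\<close> by (intro measurable_component_singleton) auto
    show ?thesis unfolding H_def by measurable
  qed
  have obs: "\<phi> (S U t l \<omega>) = H l (restrict (\<lambda>i. Z t i \<omega>) J)"
    if "t \<ge> 0" "l \<ge> 1" "\<omega> \<in> space M" "{1..N} \<times> {l} \<subseteq> J" for t l \<omega> J
  proof -
    have "(\<Sum>j=1..N. \<alpha> j U * Re (restrict (\<lambda>i. Z t i \<omega>) J (j, l)) +
        \<beta> j U * Im (restrict (\<lambda>i. Z t i \<omega>) J (j, l))) + C U = x t U (x0 l \<omega>)"
      unfolding form[OF that(1-3)]
    proof (rule arg_cong2[where f="(+)"], rule sum.cong)
      fix j assume "j \<in> {1..N}"
      then have "(j, l) \<in> J" using that(4) by auto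
      then show "\<alpha> j U * Re (restrict (\<lambda>i. Z t i \<omega>) J (j, l)) +
          \<beta> j U * Im (restrict (\<lambda>i. Z t i \<omega>) J (j, l)) =
        \<alpha> j U * cos (f j t U + \<theta> j l \<omega>) + \<beta> j U * sin (f j t U + \<theta> j l \<omega>)"
        by (simp add: Z_def)
    qed simp_all
    then show ?thesis
      using in_ab[OF that(1-3)] S[OF that(1-3)] by (simp add: H_def h_def)
  qed
  \<comment> \<open>Grouping the independent phases into disjoint blocks, one per copy, makes the
    copies independent.\<close>
  have "indep_vars (\<lambda>l. PiM ({1..N} \<times> {l}) (\<lambda>_. borel))
      (\<lambda>l \<omega>. restrict (\<lambda>i. Z 0 i \<omega>) ({1..N} \<times> {l})) {1..}"
    by (rule indep_vars_restrict[OF indep_Z]) (auto simp: I_def disjoint_family_on_def)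
  then have "indep_vars (\<lambda>_. borel) (\<lambda>l \<omega>. H l (restrict (\<lambda>i. Z 0 i \<omega>) ({1..N} \<times> {l}))) {1..}"
    by (rule indep_vars_compose2) (rule H, simp)
  \<comment> \<open>The constant is taken from time 0 and then carried over to every other
    time.\<close>
  from ensemble_avg_AE_const[OF this w] obtain c
    where c: "AE \<omega> in M. ensemble_avg w (\<lambda>l. H l (restrict (\<lambda>i. Z 0 i \<omega>) ({1..N} \<times> {l}))) = c"
    by (rule exE)
  have sub: "{1..N} \<times> {l} \<subseteq> I" if "l \<ge> 1" for l
    using that by (auto simp: I_def)
  define P where "P z \<longleftrightarrow> ensemble_avg w (\<lambda>l. H l z) = c" for z
  have "(\<lambda>z. ensemble_avg w (\<lambda>l. H l z)) \<in> borel_measurable (PiM I (\<lambda>_. borel))"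
    using H sub by (intro ensemble_avg_measurable) auto
  then have P: "{z \<in> space (PiM I (\<lambda>_. borel)). P z} \<in> sets (PiM I (\<lambda>_. borel))"
    unfolding P_def by measurable
  have "AE \<omega> in M. P (\<lambda>i\<in>I. Z 0 i \<omega>)"
    using c by (simp add: P_def H_def I_def cong: ensemble_avg_cong)
  \<comment> \<open>By \<open>distr_Z\<close> the marginal laws do not depend on time, so the almost
    sure statement at time 0 holds at time \<open>t\<close> with the same \<open>c\<close>.\<close>
  then have P_Z: "AE \<omega> in M. P (\<lambda>i\<in>I. Z t i \<omega>)" for t
    using AE_indep_vars_iff_if_distr_eq[OF indep_Z indep_Z _ P, of 0 t] distr_Z by simp
  have "AE \<omega> in M. ensemble_avg w (\<lambda>l. \<phi> (S U t l \<omega>)) = c" if "t \<ge> 0" for t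
    using P_Z[of t] AE_space
  proof eventually_elim
    case (elim \<omega>)
    then show ?case
      using obs[OF that _ _ sub] by (simp add: P_def cong: ensemble_avg_cong)
  qed
  then show "\<exists>c. \<forall>t\<ge>0. AE \<omega> in M. ensemble_avg w (\<lambda>l. \<phi> (S U t l \<omega>)) = c"
    by blast
qed

text \<open>From \<open>L = l\<close> on, the \<open>l\<close>-th weight is among those over which
  the maximum is taken.\<close>

lemma weight_tendsto_zero:
  fixes w :: "nat \<Rightarrow> nat \<Rightarrow> real"
  assumes "(\<lambda>L. Max ((\<lambda>l. \<bar>w L l\<bar>) ` {1..L})) \<longlonglongrightarrow> 0" and "l \<ge> 1"
  shows "(\<lambda>L. w L l) \<longlonglongrightarrow> 0"
proof (rule Lim_null_comparison[OF _ assms(1)])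
  show "\<forall>\<^sub>F L in sequentially. norm (w L l) \<le> Max ((\<lambda>l. \<bar>w L l\<bar>) ` {1..L})"
    using eventually_ge_at_top[of l] by eventually_elim (use \<open>l \<ge> 1\<close> in auto)
qed

theorem theoremS1:
  fixes M :: "'w measure"
    and UU :: "'u history set"
    and w :: "nat \<Rightarrow> nat \<Rightarrow> real"
    and a b :: real
    and \<phi> :: "real \<Rightarrow> real"
    and S :: "'u history \<Rightarrow> real \<Rightarrow> nat \<Rightarrow> 'w \<Rightarrow> real"
    and x :: "'u history \<Rightarrow> real \<Rightarrow> real"
    and v :: "nat \<Rightarrow> 'w \<Rightarrow> real"
    and y :: "real \<Rightarrow> 'u history \<Rightarrow> 'i \<Rightarrow> real"
    and x0 :: "nat \<Rightarrow> 'w \<Rightarrow> 'i"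
  assumes "prob_space M"
    and "UU \<subseteq> extensional {0..}"
    and "(\<lambda>L. Max ((\<lambda>l. \<bar>w L l\<bar>) ` {1..L})) \<longlonglongrightarrow> 0"
    and "a < b"
    and "noise_only M UU w a b \<phi> x v S \<or> temporal_fluctuation_only M UU w a b \<phi> y x0 S"
    and "\<forall>U\<in>UU. \<forall>t\<ge>0. AE \<omega> in M. convergent (weighted_avg w (\<lambda>l. \<phi> (S U t l \<omega>)))"
  shows "time_invariant M UU (\<lambda>U t \<omega>. ensemble_avg w (\<lambda>l. \<phi> (S U t l \<omega>)))"
  using assms(5) weight_tendsto_zero[OF assms(3)]
    time_invariant_if_noise_only[OF assms(1)] time_invariant_if_temporal_fluctuation_only[OF assms(1)]
  by metis

end
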